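(* Let $\lambda=(108,18,18,18,18)$, a partition of $180$, which is $10$-regular and $6$-distinct. Then for every integer $\ell\ge 0$ the partition $(\phi_{10}\phi_6)^\ell(\lambda)$ is not simultaneously $6$-regular and $10$-distinct. Consequently, the following assertion is false: for all $s,t$ and every $s$-regular, $t$-distinct partition $\lambda$ there exists $\ell$, depending on $\lambda$, such that $(\phi_s\phi_t)^\ell$ maps $\lambda$ to a unique $s$-distinct, $t$-regular partition, with no intervening $(\phi_s\phi_t)^k(\lambda)$ being $s$-regular and $t$-distinct.
   Context: A partition of $n$ is a nonincreasing finite sequence of positive integers (parts) with sum $n$; the frequency of a part size is its number of appearances. A partition is $m$-regular if no part is divisible by $m$, and $m$-distinct if every part size appears fewer than $m$ times. Glaisher's map $\phi_m$ ($m\ge 2$), extended to an involution on all partitions: given a partition $\lambda$, for each $j\ge 1$ with $m\nmid j$ and each $k\ge 0$, write the frequency of the part $jm^k$ in base $m$ as $\sum_{i\ge 0} a^{(j)}_{k,i}m^i$ with $0\le a^{(j)}_{k,i}<m$. Then $\phi_m(\lambda)$ is the partition in which, for each such $j$ and each $i\ge 0$, the part $jm^i$ has frequency $\sum_{k\ge 0} a^{(j)}_{k,i}m^k$ (that is, the matrices $(a^{(j)}_{k,i})_{k,i}$ are transposed). Compositions are read right to left: $\phi_{10}\phi_6(\lambda)=\phi_{10}(\phi_6(\lambda))$. *)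

theory Defs
  imports "HOL-Library.Multiset" "HOL-Computational_Algebra.Primes"
begin

definition is_partition :: "nat list \<Rightarrow> bool" where
  "is_partition p \<longleftrightarrow> sorted_wrt (\<ge>) p \<and> (\<forall>x\<in>set p. 0 < x)"

definition is_partition_of :: "nat list \<Rightarrow> nat \<Rightarrow> bool" where
  "is_partition_of p n \<longleftrightarrow> is_partition p \<and> sum_list p = n"

definition m_regular :: "nat \<Rightarrow> nat list \<Rightarrow> bool" where
  "m_regular m p \<longleftrightarrow> (\<forall>x\<in>set p. \<not> m dvd x)"

definition m_distinct :: "nat \<Rightarrow> nat list \<Rightarrow> bool" where
  "m_distinct m p \<longleftrightarrow> (\<forall>x\<in>set p. count_list p x < m)"

definition digit :: "nat \<Rightarrow> nat \<Rightarrow> nat \<Rightarrow> nat" where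
  "digit m n i = n div m ^ i mod m"

text \<open>The sum over all \<open>k \<ge> 0\<close> is restricted to those \<open>k\<close> for which \<open>j * m ^ k\<close> is a part:
  these are finitely many, and the other summands vanish.\<close>

definition is_glaisher_image :: "nat \<Rightarrow> nat list \<Rightarrow> nat list \<Rightarrow> bool" where
  "is_glaisher_image m p q \<longleftrightarrow> is_partition q \<and>
     (\<forall>j i. 1 \<le> j \<longrightarrow> \<not> m dvd j \<longrightarrow>
        count_list q (j * m ^ i) =
          (\<Sum>k | j * m ^ k \<in> set p. digit m (count_list p (j * m ^ k)) i * m ^ k))"

definition glaisher :: "nat \<Rightarrow> nat list \<Rightarrow> nat list" where
  "glaisher m p = (THE q. is_glaisher_image m p q)"

text \<open>The description determines exactly one partition, so that \<open>glaisher\<close> is well defined.\<close>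

lemma free_part_decomp:
  fixes m d :: nat
  assumes "2 \<le> m" "0 < d"
  obtains j i where "1 \<le> j" "\<not> m dvd j" "d = j * m ^ i"
proof -
  have "\<not> is_unit m" using assms by simp
  then obtain j where "d = m ^ multiplicity m d * j" "\<not> m dvd j"
    using multiplicity_decompose'[of d m] assms by auto
  then show thesis using that[of j "multiplicity m d"] assms
    by (metis One_nat_def Suc_leI gr0I dvd_0_right mult.commute)
qed

lemma multiplicity_free_part:
  fixes m j :: nat
  assumes "2 \<le> m" "\<not> m dvd j"
  shows "multiplicity m (j * m ^ i) = i"
  by (rule multiplicity_decomposeI[where x' = j]) (use assms in auto)

lemma partition_eqI:
  assumes "is_partition p" "is_partition q" "\<And>d. 0 < d \<Longrightarrow> count_list p d = count_list q d"
  shows "p = q"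
proof -
  have "count_list p d = count_list q d" for d
    using assms by (cases "d = 0") (metis count_list_0_iff is_partition_def less_irrefl, simp)
  then have "mset p = mset q"
    by (intro multiset_eqI) (simp add: count_mset)
  moreover have "sorted (rev p)" "sorted (rev q)"
    using assms by (auto simp: is_partition_def sorted_wrt_rev)
  ultimately have "rev p = rev q"
    by (metis mset_rev properties_for_sort)
  then show ?thesis by simp
qed

lemma ex1_glaisher_image:
  assumes m: "2 \<le> m" and p: "is_partition p"
  shows "\<exists>!q. is_glaisher_image m p q"
proof (rule ex_ex1I)
  define g where "g j i = (\<Sum>k | j * m ^ k \<in> set p. digit m (count_list p (j * m ^ k)) i * m ^ k)"
    for j i
  define f where "f d = (if d = 0 then 0 else g (d div m ^ multiplicity m d) (multiplicity m d))"
    for d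
  have f_eq: "f (j * m ^ i) = g j i" if "1 \<le> j" "\<not> m dvd j" for j i
    using that m multiplicity_free_part[of m j i] by (simp add: f_def)
  have "{d. 0 < f d} \<subseteq> (\<lambda>(j, i). j * m ^ i) ` ({..sum_list p} \<times> {..length p})"
  proof
    fix d assume "d \<in> {d. 0 < f d}"
    then have d: "0 < f d" "0 < d" by (auto simp: f_def split: if_splits)
    obtain j i where ji: "1 \<le> j" "\<not> m dvd j" "d = j * m ^ i"
      using free_part_decomp[OF m d(2)] .
    have "g j i \<noteq> 0" using d f_eq[OF ji(1,2)] ji by simp
    then obtain k where k: "j * m ^ k \<in> set p" "digit m (count_list p (j * m ^ k)) i \<noteq> 0"
      unfolding g_def by (metis (mono_tags, lifting) mem_Collect_eq mult_is_0 sum.neutral)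
    have "j \<le> j * m ^ k" using m by simp
    also have "\<dots> \<le> sum_list p" using k(1) by (simp add: member_le_sum_list)
    finally have "j \<le> sum_list p" .
    moreover have "m ^ i \<le> count_list p (j * m ^ k)"
      using k(2) by (metis digit_def div_less mod_0 not_le)
    moreover have "i < m ^ i" using m by (simp add: power_gt_expt)
    ultimately have "j \<le> sum_list p" "i \<le> length p"
      using count_le_length[of p "j * m ^ k"] by linarith+
    then show "d \<in> (\<lambda>(j, i). j * m ^ i) ` ({..sum_list p} \<times> {..length p})"
      using ji by auto
  qed
  then have "finite {d. 0 < f d}" by (rule finite_subset) auto
  then have cnt: "count (Abs_multiset f) = f" by (simp add: Abs_multiset_inverse)
  define q where "q = rev (sorted_list_of_multiset (Abs_multiset f))"
  have mq: "mset q = Abs_multiset f" by (simp add: q_def)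
  have cq: "count_list q d = f d" for d by (metis cnt count_mset mq)
  have "0 \<notin> set q" using cq[of 0] by (simp add: f_def count_list_0_iff)
  then have "is_partition q"
    using sorted_sorted_list_of_multiset[of "Abs_multiset f"]
    by (auto simp: is_partition_def q_def sorted_wrt_rev intro: gr0I)
  then have "is_glaisher_image m p q"
    by (simp add: is_glaisher_image_def cq f_eq g_def)
  then show "\<exists>q. is_glaisher_image m p q" ..
next
  fix q r assume *: "is_glaisher_image m p q" "is_glaisher_image m p r"
  show "q = r"
  proof (rule partition_eqI)
    fix d :: nat assume "0 < d"
    then obtain j i where "1 \<le> j" "\<not> m dvd j" "d = j * m ^ i"
      using free_part_decomp[OF m] by blast
    then show "count_list q d = count_list r d"
      using * by (simp add: is_glaisher_image_def)
  qed (use * in \<open>auto simp: is_glaisher_image_def\<close>)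
qed

lemma glaisher_image:
  assumes "2 \<le> m" "is_partition p"
  shows "is_glaisher_image m p (glaisher m p)"
  unfolding glaisher_def by (rule theI') (rule ex1_glaisher_image[OF assms])

lemma glaisher_eqI:
  assumes "2 \<le> m" "is_partition p" "is_glaisher_image m p q"
  shows "glaisher m p = q"
  using assms ex1_glaisher_image glaisher_image by blast

end

(* The orbit of (108, 18^4) under phi_10 phi_6 is the 3-cycle
     (108, 18^4) -> (30^6) -> (3^60) -> (108, 18^4),
   where exponents are frequencies. The first two partitions are not 6-regular, and the third
   is not 10-distinct. *)

theory Submission
  imports Defs
begin

lemma is_partition_replicate: "0 < d \<Longrightarrow> is_partition (replicate n d)"
  by (induction n) (auto simp: is_partition_def)

lemma count_list_replicate: "count_list (replicate n d) e = (if d = e then n else 0)"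
  by (induction n) auto

text \<open>The exponent is recovered as the multiplicity of \<open>m\<close>, even for composite
  \<open>m\<close>, and cancelling the power of \<open>m\<close> then gives the free part. Hence
  distinct free parts generate disjoint families \<open>j * m ^ i\<close>.\<close>

lemma free_part_unique:
  fixes m j j' :: nat
  assumes "2 \<le> m" "\<not> m dvd j" "\<not> m dvd j'" "j * m ^ i = j' * m ^ i'"
  shows "j = j'" "i = i'"
proof -
  show "i = i'"
    using assms multiplicity_free_part by metis
  with assms show "j = j'" by simp
qed

lemma digit_eq_0: "n < m ^ N \<Longrightarrow> 0 < m \<Longrightarrow> N \<le> i \<Longrightarrow> digit m n i = 0"
  by (simp add: digit_def) (metis div_less mod_0 less_le_trans power_increasing Suc_leI One_nat_def)

text \<open>If all parts of \<open>p\<close> share the free part \<open>j\<close>, only the digit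
  matrix of \<open>j\<close> can be nonzero. \<open>K\<close> is the set of exponents occurring in
  \<open>p\<close>, and \<open>N\<close> bounds the number of base-\<open>m\<close> digits of the
  frequencies, so the image is certified by \<open>N\<close> equations. The bounded quantifier in
  \<open>cnt\<close> can be unrolled for a concrete \<open>N\<close>.\<close>

lemma glaisher_one_family:
  assumes m: "2 \<le> m" and j: "1 \<le> j" "\<not> m dvd j"
    and p: "is_partition p" "set p = (\<lambda>k. j * m ^ k) ` K"
    and q: "is_partition q" "set q \<subseteq> (\<lambda>i. j * m ^ i) ` {..<N}"
    and small: "\<And>k. k \<in> K \<Longrightarrow> count_list p (j * m ^ k) < m ^ N"
    and cnt: "\<forall>i\<in>{..<N}.
      count_list q (j * m ^ i) = (\<Sum>k\<in>K. digit m (count_list p (j * m ^ k)) i * m ^ k)"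
  shows "glaisher m p = q"
proof (rule glaisher_eqI[OF m p(1)], unfold is_glaisher_image_def, intro conjI allI impI)
  show "is_partition q" by (rule q)
next
  fix j' i assume j': "1 \<le> j'" "\<not> m dvd j'"
  show "count_list q (j' * m ^ i) =
    (\<Sum>k | j' * m ^ k \<in> set p. digit m (count_list p (j' * m ^ k)) i * m ^ k)"
  proof (cases "j' = j")
    case False
    then have "{k. j' * m ^ k \<in> set p} = {}" "j' * m ^ i \<notin> set q"
      using free_part_unique(1)[OF m j'(2) j(2)] p(2) q(2) by blast+
    then show ?thesis by (simp add: count_list_0_iff)
  next
    case True
    have K: "{k. j * m ^ k \<in> set p} = K"
      using free_part_unique(2)[OF m j(2) j(2)] p(2) by blast
    show ?thesis
    proof (cases "i < N")
      case True
      then show ?thesis using cnt K \<open>j' = j\<close> by simp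
    next
      case False
      then have "j * m ^ i \<notin> set q"
        using free_part_unique(2)[OF m j(2) j(2)] q(2) by blast
      \<comment> \<open>Beyond position \<open>N\<close> the frequencies have no digits left, so
        both sides vanish.\<close>
      moreover have "digit m (count_list p (j * m ^ k)) i = 0" if "k \<in> K" for k
        using digit_eq_0[OF small[OF that]] m False by simp
      ultimately show ?thesis using K \<open>j' = j\<close> by (simp add: count_list_0_iff)
    qed
  qed
qed

text \<open>Regularity leaves only the row \<open>k = 0\<close> of each digit matrix, and
  distinctness only the column \<open>i = 0\<close>. A matrix supported at the corner equals its
  transpose.\<close>

lemma glaisher_regular_distinct:
  assumes m: "2 \<le> m" and p: "is_partition p" "m_regular m p" "m_distinct m p"
  shows "glaisher m p = p"
proof (rule glaisher_eqI[OF m p(1)], unfold is_glaisher_image_def, intro conjI allI impI)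
  show "is_partition p" by (rule p)
next
  fix j i
  have dvd: "k = 0" if "j * m ^ k \<in> set p" for k
    using p(2) that by (cases k) (auto simp: m_regular_def)
  then have K: "{k. j * m ^ k \<in> set p} = (if j \<in> set p then {0} else {})"
    by (auto dest: dvd) (metis dvd mult.right_neutral power_0)
  show "count_list p (j * m ^ i) =
    (\<Sum>k | j * m ^ k \<in> set p. digit m (count_list p (j * m ^ k)) i * m ^ k)"
  proof (cases "j \<in> set p")
    case True
    then have "count_list p j < m" using p(3) by (simp add: m_distinct_def)
    then have "digit m (count_list p j) i = (if i = 0 then count_list p j else 0)"
      using digit_eq_0[of "count_list p j" m 1 i] m by (auto simp: digit_def)
    moreover have "count_list p (j * m ^ i) = (if i = 0 then count_list p j else 0)"
      using dvd[of i] by (auto simp: count_list_0_iff)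
    ultimately show ?thesis using K True by simp
  next
    case False
    then have "j * m ^ i \<notin> set p" using dvd[of i] by auto
    then show ?thesis unfolding K using False by (simp add: count_list_0_iff)
  qed
qed

lemma is_partition_lambda: "is_partition [108, 18, 18, 18, 18]"
  by (simp add: is_partition_def)

text \<open>Here 108 = 3 * 6^2 and 18 = 3 * 6 have the one-digit frequencies 1 and 4, which gives 1
  * 36 + 4 * 6 = 60 copies of 3. In base 10 the digits of 60 then give six copies of 3 * 10.\<close>

lemma glaisher_orbit_1: "(glaisher 10 \<circ> glaisher 6) [108, 18, 18, 18, 18] = replicate 6 30"
proof -
  have "glaisher 6 [108, 18, 18, 18, 18] = replicate 60 3"
    by (rule glaisher_one_family[where j = 3 and K = "{1, 2}" and N = 1])
      (auto simp: is_partition_lambda is_partition_replicate count_list_replicate digit_def)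
  moreover have "glaisher 10 (replicate 60 3) = replicate 6 30"
    by (rule glaisher_one_family[where j = 3 and K = "{0}" and N = 2])
      (auto simp: is_partition_replicate count_list_replicate digit_def lessThan_nat_numeral)
  ultimately show ?thesis by simp
qed

text \<open>For base 6, 30 = 5 * 6 has frequency 6 = 1 * 6, so the only nonzero entry is on the
  diagonal and the partition is fixed. For base 10, 30 = 3 * 10 has the single digit 6 as frequency,
  which gives 6 * 10 copies of 3.\<close>

lemma glaisher_orbit_2: "(glaisher 10 \<circ> glaisher 6) (replicate 6 30) = replicate 60 3"
proof -
  have "glaisher 6 (replicate 6 30) = replicate 6 30"
    by (rule glaisher_one_family[where j = 5 and K = "{1}" and N = 2])
      (auto simp: is_partition_replicate count_list_replicate digit_def lessThan_nat_numeral)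
  moreover have "glaisher 10 (replicate 6 30) = replicate 60 3"
    by (rule glaisher_one_family[where j = 3 and K = "{1}" and N = 1])
      (auto simp: is_partition_replicate count_list_replicate digit_def)
  ultimately show ?thesis by simp
qed

text \<open>The base-6 expansion 60 = 1 * 36 + 4 * 6 + 0 yields one part 3 * 36, four parts 3 * 6
  and no part 3.\<close>

lemma glaisher_orbit_3: "(glaisher 10 \<circ> glaisher 6) (replicate 60 3) = [108, 18, 18, 18, 18]"
proof -
  have "glaisher 6 (replicate 60 3) = [108, 18, 18, 18, 18]"
    by (rule glaisher_one_family[where j = 3 and K = "{0}" and N = 3])
      (auto simp: is_partition_lambda is_partition_replicate count_list_replicate digit_def
        lessThan_nat_numeral)
  \<comment> \<open>In base 10 the parts 108 and 18 are two different free parts, so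
    \<open>glaisher_one_family\<close> does not apply.\<close>
  moreover have "glaisher 10 [108, 18, 18, 18, 18] = [108, 18, 18, 18, 18]"
    by (rule glaisher_regular_distinct)
      (auto simp: is_partition_lambda m_regular_def m_distinct_def)
  ultimately show ?thesis by simp
qed

lemma glaisher_orbit:
  "((glaisher 10 \<circ> glaisher 6) ^^ l) [108, 18, 18, 18, 18]
    \<in> {[108, 18, 18, 18, 18], replicate 6 30, replicate 60 3}"
proof (induction l)
  case 0
  show ?case by simp
next
  case (Suc l)
  then show ?case
    using glaisher_orbit_1 glaisher_orbit_2 glaisher_orbit_3
    by (simp only: funpow.simps o_apply insert_iff empty_iff) metis
qed

text \<open>In the refuted claim, \<open>k = 0\<close> is excluded because that iterate is
  \<open>p\<close> itself, which is \<open>s\<close>-regular and \<open>t\<close>-distinct by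
  assumption.\<close>

theorem mainTheorem3:
  shows "is_partition_of [108, 18, 18, 18, 18] 180
       \<and> m_regular 10 [108, 18, 18, 18, 18]
       \<and> m_distinct 6 [108, 18, 18, 18, 18]
       \<and> (\<forall>l::nat. \<not> (m_regular 6 (((glaisher 10 \<circ> glaisher 6) ^^ l) [108, 18, 18, 18, 18])
                    \<and> m_distinct 10 (((glaisher 10 \<circ> glaisher 6) ^^ l) [108, 18, 18, 18, 18])))
       \<and> \<not> (\<forall>s\<ge>2. \<forall>t\<ge>2. \<forall>p. is_partition p \<and> m_regular s p \<and> m_distinct t p \<longrightarrow>
             (\<exists>l::nat.
                (\<exists>!q. ((glaisher s \<circ> glaisher t) ^^ l) p = q \<and>
                      is_partition q \<and> m_distinct s q \<and> m_regular t q) \<and>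
                (\<forall>k. 0 < k \<and> k < l \<longrightarrow>
                   \<not> (m_regular s (((glaisher s \<circ> glaisher t) ^^ k) p) \<and>
                      m_distinct t (((glaisher s \<circ> glaisher t) ^^ k) p)))))"
proof -
  let ?p = "[108, 18, 18, 18, 18] :: nat list"
  let ?f = "glaisher 10 \<circ> glaisher 6"
  have reg: "m_regular 10 ?p" and dist: "m_distinct 6 ?p"
    by (auto simp: m_regular_def m_distinct_def)
  have orbit: "\<not> (m_regular 6 ((?f ^^ l) ?p) \<and> m_distinct 10 ((?f ^^ l) ?p))" for l
  proof -
    have "\<not> m_regular 6 ?p" "\<not> m_regular 6 (replicate 6 30)" "\<not> m_distinct 10 (replicate 60 3)"
      by (simp_all add: m_regular_def m_distinct_def count_list_replicate)
    then show ?thesis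
      using glaisher_orbit[of l] by (simp only: insert_iff empty_iff) metis
  qed
  show ?thesis (is "_ \<and> _ \<and> _ \<and> _ \<and> \<not> ?claim")
  proof (intro conjI allI)
    show "is_partition_of ?p 180"
      using is_partition_lambda by (simp add: is_partition_of_def)
    show "\<not> ?claim"
    proof
      assume ?claim
      \<comment> \<open>At \<open>s = 10\<close>, \<open>t = 6\<close>, the mere existence of a
        target in the orbit already contradicts \<open>orbit\<close>.\<close>
      then have "\<exists>l. \<exists>q. (?f ^^ l) ?p = q \<and> is_partition q \<and> m_distinct 10 q \<and> m_regular 6 q"
        using reg dist is_partition_lambda
        by (elim allE[of _ 10] allE[of _ 6] allE[of _ ?p] impE) auto
      then show False using orbit by blast
    qed
  qed (use reg dist orbit in blast)+
qed

end
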